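(* Let $k,j\ge 0$ and $m\ge 1$ be integers and put $n=2m+kj$ (so $n\ge 1$). Then, as polynomials in the indeterminates $t_1,t_2,\dots$, $$\sum_{Q\in\mathfrak{Q}_{n,k}^{m,j}}\prod_{i\geq1}t_i^{\alpha_i(Q)}=\frac{m}{(m+j+1)(m+j)}\binom{m+j}{j}\frac{\mathbf{P}_m^{(m+j+1)}(1!\,t_1,2!\,t_2,\dots)}{m!}$$ $$=\frac{m}{(m+j+1)(m+j)}\binom{m+j}{j}\sum_{r=0}^m\binom{m+j+1}{r}\frac{r!}{m!}\,\mathbf{B}_{m,r}\big(1!\,t_1,2!\,t_2,\dots\big).$$
   Context: Fix an integer $k\ge 0$. Lattice paths use the steps $u=(1,1)$ (up-step), $d=(1,-1)$ (down-step), $h=(k,0)$ (horizontal-step), and a path is regarded as the sequence (word in the letters $u,d,h$) of its steps; for $k=0$ the letter $h$ is a formal letter not changing the position. A $k$-path of length $n$ is such a path from $(0,0)$ to $(n,0)$ that never goes below the $x$-axis. $\mathfrak{P}_{n,k}^{m,j}$ is the set of $k$-paths with exactly $m$ up-steps and $j$ horizontal-steps (hence $m$ down-steps and $n=2m+kj$). $\mathfrak{Q}_{n,k}^{m,j}$ is the subset of those $k$-paths in $\mathfrak{P}_{n,k}^{m,j}$ having no horizontal-step on the $x$-axis (i.e. at height $0$). A $u$-segment of a path is a maximal sequence of consecutive up-steps. $\alpha_i(Q)$ is the number of $u$-segments of length $i$ (i.e. with exactly $i$ up-steps) in $Q$. $\mathbf{B}_{m,r}(x_1,x_2,\dots)$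 is the partial Bell polynomial $\sum \frac{m!}{r_1!r_2!\cdots r_m!}\left(\frac{x_1}{1!}\right)^{r_1}\cdots\left(\frac{x_m}{m!}\right)^{r_m}$, the sum being over nonnegative integers with $r_1+\cdots+r_m=r$ and $r_1+2r_2+\cdots+mr_m=m$. The potential polynomials $\mathbf{P}_m^{(\lambda)}=\mathbf{P}_m^{(\lambda)}(f_1,f_2,\dots)$ are defined by $1+\sum_{m\ge1}\mathbf{P}_m^{(\lambda)}\frac{x^m}{m!}=\Big(1+\sum_{m\ge1}f_m\frac{x^m}{m!}\Big)^{\lambda}$. *)

theory Defs
  imports
    "HOL-Library.Poly_Mapping"
    "HOL-Computational_Algebra.Formal_Power_Series"
begin

datatype step = U | D | H

type_synonym path = "step list"

fun step_vec :: "nat \<Rightarrow> step \<Rightarrow> int \<times> int" where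
  "step_vec k U = (1, 1)"
| "step_vec k D = (1, -1)"
| "step_vec k H = (int k, 0)"

definition xpos :: "nat \<Rightarrow> path \<Rightarrow> int" where
  "xpos k p = (\<Sum>s\<leftarrow>p. fst (step_vec k s))"

definition ypos :: "nat \<Rightarrow> path \<Rightarrow> int" where
  "ypos k p = (\<Sum>s\<leftarrow>p. snd (step_vec k s))"

definition k_path :: "nat \<Rightarrow> nat \<Rightarrow> path \<Rightarrow> bool" where
  "k_path k n p \<longleftrightarrow>
     xpos k p = int n \<and> ypos k p = 0 \<and> (\<forall>i\<le>length p. 0 \<le> ypos k (take i p))"

text \<open>The number of down-steps is forced to be \<open>m\<close> by the final height, so these
  sets are finite, also for \<open>k = 0\<close>.\<close>

definition P_paths :: "nat \<Rightarrow> nat \<Rightarrow> nat \<Rightarrow> nat \<Rightarrow> path set" where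
  "P_paths n k m j = {p. k_path k n p \<and> count_list p U = m \<and> count_list p H = j}"

definition Q_paths :: "nat \<Rightarrow> nat \<Rightarrow> nat \<Rightarrow> nat \<Rightarrow> path set" where
  "Q_paths n k m j =
     {p \<in> P_paths n k m j. \<forall>i<length p. p ! i = H \<longrightarrow> ypos k (take i p) \<noteq> 0}"

text \<open>\<open>u_segment p a i\<close>: the \<open>i\<close> steps at the (0-based) positions \<open>a, \<dots>, a + i - 1\<close>
  form a maximal nonempty run of up-steps.\<close>

definition u_segment :: "path \<Rightarrow> nat \<Rightarrow> nat \<Rightarrow> bool" where
  "u_segment p a i \<longleftrightarrow>
     1 \<le> i \<and> a + i \<le> length p \<and> (\<forall>l\<in>{a..<a + i}. p ! l = U) \<and>
     (a = 0 \<or> p ! (a - 1) \<noteq> U) \<and> (a + i = length p \<or> p ! (a + i) \<noteq> U)"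

definition alpha :: "nat \<Rightarrow> path \<Rightarrow> nat" where
  "alpha i p = card {a. u_segment p a i}"

text \<open>Polynomials with rational coefficients in the indeterminates \<open>t\<^sub>0, t\<^sub>1, \<dots>\<close>, as the
  monoid algebra over finitely supported exponent vectors; \<open>t\<^sub>0\<close> is never used.\<close>

type_synonym qpoly = "(nat \<Rightarrow>\<^sub>0 nat) \<Rightarrow>\<^sub>0 rat"

definition const :: "rat \<Rightarrow> qpoly" where
  "const c = Poly_Mapping.single 0 c"

definition indet :: "nat \<Rightarrow> qpoly" where
  "indet i = Poly_Mapping.single (Poly_Mapping.single i 1) 1"

text \<open>The product over all \<open>i \<ge> 1\<close>; a u-segment is no longer than the path, so all
  factors with \<open>i > length p\<close> equal \<open>1\<close>.\<close>

definition path_weight :: "path \<Rightarrow> qpoly" where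
  "path_weight p = (\<Prod>i = 1..length p. indet i ^ alpha i p)"

text \<open>For the following two definitions only the values \<open>x i\<close>, \<open>f i\<close> with \<open>i \<ge> 1\<close> matter.
  The function \<open>\<rho>\<close> is the tuple \<open>(r\<^sub>1, \<dots>, r\<^sub>m)\<close>, extended by zero.\<close>

definition bell_index :: "nat \<Rightarrow> nat \<Rightarrow> (nat \<Rightarrow> nat) set" where
  "bell_index m r =
     {\<rho>. (\<forall>i. i \<notin> {1..m} \<longrightarrow> \<rho> i = 0) \<and> (\<Sum>i = 1..m. \<rho> i) = r \<and> (\<Sum>i = 1..m. i * \<rho> i) = m}"

definition partial_bell :: "nat \<Rightarrow> nat \<Rightarrow> (nat \<Rightarrow> qpoly) \<Rightarrow> qpoly" where
  "partial_bell m r x =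
     (\<Sum>\<rho>\<in>bell_index m r.
        const (fact m / (\<Prod>i = 1..m. fact (\<rho> i))) *
        (\<Prod>i = 1..m. (const (1 / fact i) * x i) ^ \<rho> i))"

text \<open>Potential polynomials \<open>P\<^sub>m\<^sup>\<lambda>\<close>, for exponents \<open>\<lambda>\<close> that are natural numbers.\<close>

definition potential_poly :: "nat \<Rightarrow> nat \<Rightarrow> (nat \<Rightarrow> qpoly) \<Rightarrow> qpoly" where
  "potential_poly m l f =
     const (fact m) *
     fps_nth ((1 + Abs_fps (\<lambda>i. if i = 0 then 0 else const (1 / fact i) * f i)) ^ l) m"

end

theory Submission imports Defs begin

text \<open>A path in \<open>Q_paths\<close> is a word in which every \<open>D\<close> and every \<open>H\<close> starts at positive height. Cut it
  before each of its \<open>N = m + j\<close> letters other than \<open>U\<close>: with \<open>a\<^sub>i \<ge> 0\<close> the length of the run of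
  \<open>U\<close> after the \<open>i\<close>-th of these letters, the heights at the cuts and at the end form a sequence
  that starts at \<open>a\<^sub>0\<close>, moves by \<open>a\<^sub>i - 1\<close> (letter \<open>D\<close>) or \<open>a\<^sub>i\<close> (letter \<open>H\<close>), and first hits \<open>0\<close>
  at time \<open>N\<close>. With \<open>T = 1 + t\<^sub>1 x + t\<^sub>2 x\<^sup>2 + \<dots>\<close>, the hitting time theorem gives such
  sequences from height \<open>g\<close> with \<open>M\<close> letters \<open>U\<close> to come the total weight
  \<open>g / N * (N choose j) * [x\<^sup>M] T\<^sup>N\<close>, and convolving over the first run \<open>g = a\<^sub>0\<close> turns this
  into \<open>(N choose j) / N * [x\<^sup>m] (x T' T\<^sup>N) = m / (N (N + 1)) * (N choose j) * [x\<^sup>m] T\<^bsup>N + 1\<^esup>\<close>.\<close>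

unbundle fps_syntax

section \<open>Rational constants in the polynomial ring\<close>

lemma const_1 [simp]: "const 1 = 1"
  by (simp add: const_def)

lemma const_mult: "const (a * b) = const a * const b"
  by (simp add: const_def mult_single)

lemma const_of_nat: "const (of_nat n) = of_nat n"
  by (simp add: const_def)

text \<open>Closed forms are proved with cleared denominators, as \<open>qpoly\<close> has no
  division; cancelling the nonzero \<open>of_nat b\<close> turns them into rational
  coefficients.\<close>

lemma const_eqI:
  assumes "b \<noteq> 0" "of_nat b * x = of_nat a * y"
  shows "x = const (of_nat a / of_nat b) * y"
proof -
  have "const (of_nat b) * const (of_nat a / of_nat b) = const (of_nat a)"
    using assms(1) by (simp flip: const_mult)
  then have "of_nat b * (const (of_nat a / of_nat b) * y) = of_nat b * x"
    using assms(2) by (simp add: const_of_nat flip: mult.assoc)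
  then show ?thesis using assms(1) by simp
qed

subsection \<open>Paths as words\<close>

text \<open>The starting height \<open>g\<close> is a parameter because cutting off a first run
  leaves words that start above the axis.\<close>

fun admissible :: "nat \<Rightarrow> path \<Rightarrow> bool" where
  "admissible g [] \<longleftrightarrow> g = 0"
| "admissible g (U # w) \<longleftrightarrow> admissible (Suc g) w"
| "admissible g (D # w) \<longleftrightarrow> 0 < g \<and> admissible (g - 1) w"
| "admissible g (H # w) \<longleftrightarrow> 0 < g \<and> admissible g w"

text \<open>Horizontal steps keep the height, so \<open>k\<close> is arbitrary. Each clause of
  \<open>admissible\<close> checks position 0 and hands the other positions to the tail.\<close>

lemma admissible_iff:
  "admissible g p \<longleftrightarrow> int g + ypos k p = 0 \<and> (\<forall>i\<le>length p. 0 \<le> int g + ypos k (take i p)) \<and>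
     (\<forall>i<length p. p ! i = H \<longrightarrow> int g + ypos k (take i p) \<noteq> 0)"
proof (induction p arbitrary: g)
  case Nil
  show ?case by (simp add: ypos_def)
next
  case (Cons s w)
  have le: "(\<forall>i\<le>Suc n. P i) \<longleftrightarrow> P 0 \<and> (\<forall>i\<le>n. P (Suc i))" for P :: "nat \<Rightarrow> bool" and n
    by (metis Suc_le_mono not0_implies_Suc zero_le)
  have less: "(\<forall>i<Suc n. P i) \<longleftrightarrow> P 0 \<and> (\<forall>i<n. P (Suc i))" for P :: "nat \<Rightarrow> bool" and n
    by (rule All_less_Suc2)
  have y: "ypos k [] = 0" "ypos k (t # v) = snd (step_vec k t) + ypos k v" for t v
    by (simp_all add: ypos_def)
  have y0: "ypos k (take 0 w) = 0" by (simp add: y)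
  show ?case
  proof (cases s)
    case U
    then show ?thesis
      using Cons.IH[of "Suc g"] by (simp add: le less y algebra_simps)
  next
    case D
    show ?thesis
    proof (cases g)
      case 0
      \<comment> \<open>After a \<open>D\<close> from height 0 every prefix of \<open>w\<close>
        would need positive height, which the empty prefix violates.\<close>
      have "\<not> (\<forall>i\<le>length w. 0 < ypos k (take i w))"
        using y0 by (metis less_irrefl zero_le)
      then show ?thesis using D 0 by (simp add: le less y)
    next
      case (Suc g')
      then show ?thesis
        using D Cons.IH[of g'] by (simp add: le less y algebra_simps)
    qed
  next
    case H
    then show ?thesis
      using Cons.IH[of g] by (auto simp add: le less y)
  qed
qed

lemma length_eq_count_list: "length p = count_list p U + count_list p D + count_list p H"
  by (induction p) (auto, (metis step.exhaust)+)

lemma admissible_count_D: "admissible g p \<Longrightarrow> count_list p D = g + count_list p U"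
  by (induction g p rule: admissible.induct) auto

lemma xpos_eq: "xpos k p = int (count_list p U + count_list p D + k * count_list p H)"
proof (induction p)
  case Nil
  show ?case by (simp add: xpos_def)
next
  case (Cons s p)
  then show ?case by (cases s) (simp_all add: xpos_def algebra_simps)
qed

text \<open>The number of letters \<open>D\<close> is forced to be \<open>g + M\<close>, so
  \<open>N = g + M + j\<close> counts the letters other than \<open>U\<close>.\<close>

definition words :: "nat \<Rightarrow> nat \<Rightarrow> nat \<Rightarrow> path set" where
  "words g M j = {w. admissible g w \<and> count_list w U = M \<and> count_list w H = j}"

definition words_not_U :: "nat \<Rightarrow> nat \<Rightarrow> nat \<Rightarrow> path set" where
  "words_not_U g M j = {w \<in> words g M j. w \<noteq> [] \<and> hd w \<noteq> U}"

text \<open>The letter counts determine the abscissa of the endpoint, so \<open>k\<close> disappears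
  from here on.\<close>

lemma Q_paths_eq_words:
  assumes "n = 2 * m + k * j"
  shows "Q_paths n k m j = words 0 m j"
proof -
  have "p \<in> Q_paths n k m j \<longleftrightarrow> p \<in> words 0 m j" for p
    using admissible_iff[of 0 p k] admissible_count_D[of 0 p] assms xpos_eq[of k p]
    unfolding Q_paths_def P_paths_def words_def k_path_def by auto
  then show ?thesis by blast
qed

lemma finite_words: "finite (words g M j)"
proof (rule finite_subset)
  show "words g M j \<subseteq> {w. set w \<subseteq> {U, D, H} \<and> length w = g + 2 * M + j}"
  proof
    fix w assume "w \<in> words g M j"
    then have "length w = g + 2 * M + j"
      using length_eq_count_list[of w] admissible_count_D[of g w] by (simp add: words_def)
    moreover have "s \<in> {U, D, H}" for s by (cases s) auto
    ultimately show "w \<in> {w. set w \<subseteq> {U, D, H} \<and> length w = g + 2 * M + j}" by blast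
  qed
  show "finite {w. set w \<subseteq> {U, D, H} \<and> length w = g + 2 * M + j}"
    by (rule finite_lists_length_eq) simp
qed

lemma finite_words_not_U: "finite (words_not_U g M j)"
  unfolding words_not_U_def using finite_words by simp

lemma count_list_replicate: "count_list (replicate a x) y = (if x = y then a else 0)"
  by (induction a) auto

lemma admissible_replicate_append: "admissible g (replicate a U @ w) = admissible (g + a) w"
  by (induction a arbitrary: g) auto

lemma words_not_U_0: "words_not_U 0 M j = {}"
proof -
  have "\<not> (admissible 0 w \<and> w \<noteq> [] \<and> hd w \<noteq> U)" for w
    by (cases "(0::nat, w)" rule: admissible.cases) auto
  then show ?thesis by (auto simp: words_not_U_def words_def)
qed

text \<open>Removal of the first letter. The case \<open>j = 0\<close> is separate because the
  truncated \<open>j - 1\<close> would be 0 again.\<close>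

lemma words_not_U_Suc:
  "words_not_U (Suc g) M j =
     (#) D ` words g M j \<union> (if j = 0 then {} else (#) H ` words (Suc g) M (j - 1))"
proof (rule set_eqI)
  fix w
  show "w \<in> words_not_U (Suc g) M j \<longleftrightarrow>
    w \<in> (#) D ` words g M j \<union> (if j = 0 then {} else (#) H ` words (Suc g) M (j - 1))"
  proof (cases w)
    case Nil
    then show ?thesis by (auto simp: words_not_U_def)
  next
    case (Cons s v)
    then show ?thesis
      by (cases s) (auto simp: words_not_U_def words_def)
  qed
qed

subsection \<open>Weights\<close>

text \<open>These are the coefficients of \<open>T\<close>; an empty run contributes the factor
  1.\<close>

definition seg_weight :: "nat \<Rightarrow> qpoly" where
  "seg_weight a = (if a = 0 then 1 else indet a)"

lemma u_segment_subset: "{b. u_segment p b i} \<subseteq> {..length p}"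
  by (auto simp: u_segment_def)

lemma u_segment_start: "u_segment p b i \<Longrightarrow> b < length p \<and> p ! b = U"
  by (simp add: u_segment_def)

text \<open>Allows words of different lengths to be compared over one range of
  \<open>i\<close>.\<close>

lemma path_weight_eq:
  assumes "length p \<le> L"
  shows "path_weight p = (\<Prod>i = 1..L. indet i ^ alpha i p)"
  unfolding path_weight_def
proof (rule prod.mono_neutral_left)
  show "\<forall>i\<in>{1..L} - {1..length p}. indet i ^ alpha i p = 1"
    by (auto simp: alpha_def u_segment_def)
qed (use assms in auto)

text \<open>The assumption on \<open>w\<close> keeps the initial run from merging with a run of
  \<open>w\<close>.\<close>

lemma u_segment_replicate_append:
  assumes "w = [] \<or> hd w \<noteq> U"
  shows "u_segment (replicate a U @ w) b i \<longleftrightarrow>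
    (b = 0 \<and> i = a \<and> 0 < a) \<or> (a \<le> b \<and> u_segment w (b - a) i)"
proof -
  let ?p = "replicate a U @ w"
  have nth: "?p ! l = (if l < a then U else w ! (l - a))" for l
    by (simp add: nth_append)
  have w0: "w ! 0 \<noteq> U" if "0 < length w"
    using that assms by (cases w) auto
  show ?thesis
  proof (cases "a \<le> b")
    case True
    then obtain c where b: "b = a + c" using le_Suc_ex by blast
    have "u_segment ?p (a + c) i \<longleftrightarrow> u_segment w c i"
    \<comment> \<open>At the junction \<open>c = 0\<close> left maximality means different things in
      the two words, but no segment starts there, as \<open>w\<close> does not begin with
      \<open>U\<close>. For \<open>c > 0\<close> the left neighbours agree.\<close>
    proof (cases c)
      case 0
      have "\<not> u_segment w 0 i" "\<not> u_segment ?p a i"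
        using w0 u_segment_start[of w 0 i] u_segment_start[of ?p a i] by (auto simp: nth)
      then show ?thesis using 0 by simp
    next
      case (Suc c')
      have "(\<forall>l\<in>{a + c..<a + c + i}. ?p ! l = U) \<longleftrightarrow> (\<forall>l\<in>{c..<c + i}. w ! l = U)"
      proof -
        have "{a + c..<a + c + i} = (+) a ` {c..<c + i}"
          by (simp add: add_ac)
        then show ?thesis by (simp only: ball_simps nth) simp
      qed
      then show ?thesis using Suc by (simp add: u_segment_def nth)
    qed
    moreover have "\<not> u_segment w 0 i" using w0 u_segment_start by blast
    ultimately show ?thesis using b by auto
  next
    case False
    \<comment> \<open>Left maximality forces the start 0, right maximality excludes shorter
      segments, and the letter after the run excludes longer ones.\<close>
    have "u_segment ?p b i \<longleftrightarrow> b = 0 \<and> i = a"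
    proof
      assume seg: "u_segment ?p b i"
      have "b = 0" using seg False by (auto simp: u_segment_def nth split: if_splits)
      moreover have "\<not> i < a" using seg False \<open>b = 0\<close> by (auto simp: u_segment_def nth)
      moreover have "\<not> a < i"
      proof
        assume "a < i"
        then have "a \<in> {b..<b + i}" "0 < length w"
          using \<open>b = 0\<close> seg by (auto simp: u_segment_def)
        then have "?p ! a = U" using seg unfolding u_segment_def by blast
        then show False using w0 \<open>0 < length w\<close> by (simp add: nth)
      qed
      ultimately show "b = 0 \<and> i = a" by simp
    next
      assume "b = 0 \<and> i = a"
      then show "u_segment ?p b i" using False w0 by (auto simp: u_segment_def nth)
    qed
    then show ?thesis using False by auto
  qed
qed

lemma alpha_replicate_append:
  assumes "w = [] \<or> hd w \<noteq> U"
  shows "alpha i (replicate a U @ w) = (if i = a \<and> 0 < a then 1 else 0) + alpha i w"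
proof -
  let ?B = "{b. u_segment w b i}"
  have eq: "{b. u_segment (replicate a U @ w) b i} =
      (if i = a \<and> 0 < a then {0} else {}) \<union> (+) a ` ?B"
    unfolding u_segment_replicate_append[OF assms] by (auto simp: image_iff) (metis le_add_diff_inverse)+
  have "finite ?B" using u_segment_subset finite_subset by blast
  moreover have "card ((+) a ` ?B) = card ?B" by (rule card_image) simp
  moreover have "0 \<notin> (+) a ` ?B" if "0 < a" using that by auto
  ultimately show ?thesis unfolding alpha_def eq by (auto split: if_splits)
qed

lemma path_weight_replicate_append:
  assumes "w = [] \<or> hd w \<noteq> U"
  shows "path_weight (replicate a U @ w) = seg_weight a * path_weight w"
proof -
  let ?L = "a + length w"
  have "path_weight (replicate a U @ w) =
    (\<Prod>i = 1..?L. (if i = a \<and> 0 < a then indet i else 1) * indet i ^ alpha i w)"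
    by (subst path_weight_eq[of _ ?L])
       (auto simp: alpha_replicate_append[OF assms] intro!: prod.cong)
  also have "\<dots> = (\<Prod>i = 1..?L. if i = a \<and> 0 < a then indet i else 1) * path_weight w"
    by (simp add: prod.distrib path_weight_eq[of w ?L])
  also have "(\<Prod>i = 1..?L. if i = a \<and> 0 < a then indet i else 1) = seg_weight a"
    by (cases "a = 0") (simp_all add: seg_weight_def)
  finally show ?thesis .
qed

lemma path_weight_Nil: "path_weight [] = 1"
  by (simp add: path_weight_def)

lemma path_weight_Cons:
  assumes "s \<noteq> U"
  shows "path_weight (s # w) = path_weight w"
proof -
  have "u_segment (s # w) b i \<longleftrightarrow> (\<exists>c. b = Suc c \<and> u_segment w c i)" for b i
  proof (cases b)
    case 0
    have "\<not> u_segment (s # w) 0 i"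
      using assms u_segment_start by fastforce
    then show ?thesis using 0 by simp
  next
    case (Suc c)
    have "{Suc c..<Suc c + i} = Suc ` {c..<c + i}" by simp
    then have "(\<forall>l\<in>{Suc c..<Suc c + i}. (s # w) ! l = U) \<longleftrightarrow> (\<forall>l\<in>{c..<c + i}. w ! l = U)"
      by (simp only: ball_simps nth_Cons_Suc)
    \<comment> \<open>For \<open>c = 0\<close> the left neighbour is \<open>s\<close>, which bounds
      a run just as the beginning of \<open>w\<close> does.\<close>
    then show ?thesis using Suc assms by (cases c) (auto simp: u_segment_def)
  qed
  then have "{b. u_segment (s # w) b i} = Suc ` {c. u_segment w c i}" for i
    by auto
  then have "alpha i (s # w) = alpha i w" for i
    by (simp add: alpha_def card_image)
  then show ?thesis
    by (simp add: path_weight_eq[of _ "length (s # w)"])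
qed

section \<open>Recurrences for the weighted sums over words\<close>

definition word_sum :: "nat \<Rightarrow> nat \<Rightarrow> nat \<Rightarrow> qpoly" where
  "word_sum g M j = (\<Sum>w\<in>words g M j. path_weight w)"

definition word_sum_not_U :: "nat \<Rightarrow> nat \<Rightarrow> nat \<Rightarrow> qpoly" where
  "word_sum_not_U g M j = (\<Sum>w\<in>words_not_U g M j. path_weight w)"

lemma word_sum_not_U_0: "word_sum_not_U 0 M j = 0"
  by (simp add: word_sum_not_U_def words_not_U_0)

lemma word_sum_not_U_Suc:
  "word_sum_not_U (Suc g) M j =
     word_sum g M j + (if j = 0 then 0 else word_sum (Suc g) M (j - 1))"
proof -
  have im: "(\<Sum>w\<in>(#) s ` A. path_weight w) = (\<Sum>w\<in>A. path_weight w)" if "s \<noteq> U" for s A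
    using that by (subst sum.reindex) (auto simp: path_weight_Cons)
  show ?thesis
    unfolding word_sum_not_U_def words_not_U_Suc word_sum_def
    by (subst sum.union_disjoint) (auto simp: finite_words im)
qed

lemma word_sum_0: "word_sum 0 0 0 = 1"
proof -
  have "words 0 0 0 = {[]}"
  proof -
    have "w \<in> words 0 0 0 \<longleftrightarrow> w = []" for w
      using admissible_count_D[of 0 w] length_eq_count_list[of w] by (auto simp: words_def)
    then show ?thesis by blast
  qed
  then show ?thesis by (simp add: word_sum_def path_weight_Nil)
qed

text \<open>Splitting off the first, possibly empty, run of \<open>U\<close> is a bijection. The
  remainder is nonempty: otherwise \<open>g + a = 0\<close>, \<open>j = 0\<close> and
  \<open>M = a\<close>, against the assumption.\<close>

lemma word_sum_decompose:
  assumes "0 < g + M + j"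
  shows "word_sum g M j = (\<Sum>a\<le>M. seg_weight a * word_sum_not_U (g + a) (M - a) j)"
proof -
  have "(\<Sum>a\<le>M. seg_weight a * word_sum_not_U (g + a) (M - a) j) =
      (\<Sum>(a, w)\<in>Sigma {..M} (\<lambda>a. words_not_U (g + a) (M - a) j). seg_weight a * path_weight w)"
    unfolding word_sum_not_U_def sum_distrib_left
    by (subst sum.Sigma) (auto simp: finite_words_not_U)
  also have "\<dots> = (\<Sum>w\<in>words g M j. path_weight w)"
  proof (rule sum.reindex_bij_witness
      [where i = "\<lambda>w. (length (takeWhile ((=) U) w), dropWhile ((=) U) w)"
         and j = "\<lambda>(a, w). replicate a U @ w"])
    fix x assume x: "x \<in> Sigma {..M} (\<lambda>a. words_not_U (g + a) (M - a) j)"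
    obtain a w where [simp]: "x = (a, w)" by (cases x)
    have w: "w \<noteq> []" "hd w \<noteq> U" "a \<le> M" "w \<in> words (g + a) (M - a) j"
      using x by (auto simp: words_not_U_def)
    then obtain s v where [simp]: "w = s # v" "s \<noteq> U" "U \<noteq> s" by (cases w) auto
    show "(\<lambda>w. (length (takeWhile ((=) U) w), dropWhile ((=) U) w))
        ((\<lambda>(a, w). replicate a U @ w) x) = x"
      by (simp add: takeWhile_append dropWhile_append)
    show "(\<lambda>(a, w). replicate a U @ w) x \<in> words g M j"
      using w by (auto simp: words_def admissible_replicate_append count_list_replicate)
    show "path_weight ((\<lambda>(a, w). replicate a U @ w) x) =
        (case x of (a, w) \<Rightarrow> seg_weight a * path_weight w)"
      by (simp add: path_weight_replicate_append)
  next
    fix p assume p: "p \<in> words g M j"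
    define a where "a = length (takeWhile ((=) U) p)"
    define w where "w = dropWhile ((=) U) p"
    have "takeWhile ((=) U) p = replicate a U"
      unfolding a_def by (rule replicate_eqI[symmetric, THEN sym]) (auto dest: set_takeWhileD)
    then have eq: "p = replicate a U @ w"
      unfolding w_def by (metis takeWhile_dropWhile_id)
    have adm: "admissible (g + a) w" "count_list w H = j" "a + count_list w U = M"
      using p unfolding eq by (auto simp: words_def admissible_replicate_append count_list_replicate)
    have ne: "w \<noteq> []" using adm assms by auto
    then have "hd w \<noteq> U" unfolding w_def using hd_dropWhile by metis
    then show "(length (takeWhile ((=) U) p), dropWhile ((=) U) p)
        \<in> Sigma {..M} (\<lambda>a. words_not_U (g + a) (M - a) j)"
      using adm ne unfolding a_def[symmetric] w_def[symmetric]
      by (auto simp: words_not_U_def words_def)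
    show "(\<lambda>(a, w). replicate a U @ w)
        (length (takeWhile ((=) U) p), dropWhile ((=) U) p) = p"
      unfolding a_def[symmetric] w_def[symmetric] using eq by simp
  qed
  finally show ?thesis unfolding word_sum_def by simp
qed

subsection \<open>The hitting time formula\<close>

definition seg_fps :: "qpoly fps" where
  "seg_fps = Abs_fps seg_weight"

lemma convolution_power:
  fixes f :: "'a::comm_ring_1 fps"
  shows "(\<Sum>a\<le>M. f $ a * (f ^ N) $ (M - a)) = (f ^ Suc N) $ M"
  by (simp add: fps_mult_nth atMost_atLeast0)

text \<open>Compares coefficients in \<open>x (f^(N+1))' = (N+1) x f' f^N\<close>, where
  \<open>x d/dx\<close> multiplies the \<open>i\<close>-th coefficient by \<open>i\<close>.\<close>

lemma weighted_convolution_power: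
  fixes f :: "'a::comm_ring_1 fps"
  shows "of_nat (Suc N) * (\<Sum>a\<le>M. of_nat a * f $ a * (f ^ N) $ (M - a)) = of_nat M * (f ^ Suc N) $ M"
proof -
  have "fps_X * fps_deriv (f ^ Suc N) = of_nat (Suc N) * (fps_X * fps_deriv f * f ^ N)"
    by (simp add: fps_deriv_power fps_of_nat mult_ac del: power_Suc of_nat_Suc)
  then have "(fps_X * fps_deriv (f ^ Suc N)) $ M = of_nat (Suc N) * (fps_X * fps_deriv f * f ^ N) $ M"
    by (simp add: fps_mult_left_const_nth flip: fps_of_nat)
  moreover have X: "(fps_X * fps_deriv h) $ i = of_nat i * h $ i" for h :: "'a fps" and i
    by (cases i) auto
  ultimately show ?thesis
    by (simp add: X fps_mult_nth[of "fps_X * fps_deriv f"] atMost_atLeast0 del: power_Suc)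
qed

text \<open>The arithmetic of the induction step for the hitting time formula at height
  \<open>Suc g\<close>: the summands on the left come from a first letter \<open>D\<close> and a
  first letter \<open>H\<close>.\<close>

lemma binomial_step:
  fixes g M j n :: nat
  assumes "n = g + M + j"
  shows "(g * Suc n + M) * (n choose j) +
     (if j = 0 then 0 else (Suc g * Suc n + M) * (n choose (j - 1))) = n * (Suc g * (Suc n choose j))"
proof (cases j)
  case 0
  then show ?thesis using assms by (simp add: algebra_simps)
next
  case (Suc i)
  \<comment> \<open>By Pascal's rule the claim reduces to this identity, since
    \<open>n - i = g + M + 1\<close>.\<close>
  have "Suc i * (n choose Suc i) = (n - i) * (n choose i)"
    by (simp only: binomial_absorption binomial_absorb_comp)
  then show ?thesis using assms Suc by (simp add: algebra_simps)
qed

text \<open>Moving \<open>a\<close> letters into the height keeps \<open>N\<close> fixed. The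
  formula for words starting at a cut is a hypothesis, so that the induction on \<open>N\<close> can
  supply its induction hypothesis here.\<close>

lemma word_sum_from_not_U:
  assumes "\<And>g M j. N = g + M + j \<Longrightarrow>
    of_nat N * word_sum_not_U g M j = of_nat (g * (N choose j)) * (seg_fps ^ N) $ M"
  and "N = g + M + j" "0 < N"
  shows "of_nat (N * Suc N) * word_sum g M j =
    of_nat ((g * Suc N + M) * (N choose j)) * (seg_fps ^ Suc N) $ M"
proof -
  define c where "c N M = (seg_fps ^ N) $ M" for N M
  have t: "seg_weight a = seg_fps $ a" for a by (simp add: seg_fps_def)
  have "of_nat N * word_sum g M j =
      (\<Sum>a\<le>M. seg_weight a * (of_nat N * word_sum_not_U (g + a) (M - a) j))"
    using assms(2,3) by (simp add: word_sum_decompose sum_distrib_left mult.left_commute)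
  also have "\<dots> = (\<Sum>a\<le>M. seg_weight a * (of_nat ((g + a) * (N choose j)) * c N (M - a)))"
  proof (rule sum.cong[OF refl])
    fix a assume "a \<in> {..M}"
    then have "N = (g + a) + (M - a) + j" using assms(2) by simp
    then show "seg_weight a * (of_nat N * word_sum_not_U (g + a) (M - a) j) =
        seg_weight a * (of_nat ((g + a) * (N choose j)) * c N (M - a))"
      unfolding c_def using assms(1)[of "g + a" "M - a" j] by argo
  qed
  \<comment> \<open>Split the factor \<open>g + a\<close>: the part \<open>g\<close> gives a plain
    convolution, the part \<open>a\<close> the derivative.\<close>
  also have "\<dots> = of_nat (N choose j) * (of_nat g * (\<Sum>a\<le>M. seg_weight a * c N (M - a)) +
      (\<Sum>a\<le>M. of_nat a * seg_weight a * c N (M - a)))"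
    unfolding sum_distrib_left distrib_left sum.distrib[symmetric]
    by (intro sum.cong refl) (simp add: algebra_simps)
  also have "(\<Sum>a\<le>M. seg_weight a * c N (M - a)) = c (Suc N) M"
    unfolding c_def t by (rule convolution_power)
  finally have "of_nat (N * Suc N) * word_sum g M j = of_nat (N choose j) *
      (of_nat (g * Suc N) * c (Suc N) M +
       of_nat (Suc N) * (\<Sum>a\<le>M. of_nat a * seg_weight a * c N (M - a)))"
    by (simp add: algebra_simps)
  also have "of_nat (Suc N) * (\<Sum>a\<le>M. of_nat a * seg_weight a * c N (M - a)) = of_nat M * c (Suc N) M"
    unfolding c_def t by (rule weighted_convolution_power)
  finally show ?thesis by (simp add: c_def algebra_simps)
qed

text \<open>The hitting time formula, by induction on \<open>N\<close>: removing the first letter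
  leaves an arbitrary word with one letter other than \<open>U\<close> fewer.\<close>

lemma word_sum_not_U_closed:
  assumes "N = g + M + j" "0 < N"
  shows "of_nat N * word_sum_not_U g M j = of_nat (g * (N choose j)) * (seg_fps ^ N) $ M"
  using assms
proof (induction N arbitrary: g M j)
  case 0
  then show ?case by simp
next
  case (Suc n)
  show ?case
  proof (cases g)
    case 0
    then show ?thesis by (simp add: word_sum_not_U_0)
  next
    case g: (Suc g')
    show ?thesis
    \<comment> \<open>Below, the identity is multiplied by \<open>n\<close> and \<open>n\<close> is
      cancelled at the end, so \<open>n = 0\<close> needs its own treatment; there the only word is
      the single letter \<open>D\<close>.\<close>
    proof (cases "n = 0")
      case True
      then have "g' = 0" "M = 0" "j = 0" using Suc.prems g by auto
      then show ?thesis
        using True g by (simp add: word_sum_not_U_Suc word_sum_0 seg_fps_def seg_weight_def)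
    next
      case False
      have E: "of_nat (n * Suc n) * word_sum g M j =
          of_nat ((g * Suc n + M) * (n choose j)) * (seg_fps ^ Suc n) $ M"
        if "n = g + M + j" for g M j
        using word_sum_from_not_U[of n, OF Suc.IH] that False by blast
      have n: "n = g' + M + j" using Suc.prems g by simp
      have "of_nat (n * Suc n) * word_sum_not_U g M j =
         of_nat (n * Suc n) * word_sum g' M j +
         (if j = 0 then 0 else of_nat (n * Suc n) * word_sum (Suc g') M (j - 1))"
        unfolding g word_sum_not_U_Suc by (simp add: distrib_left)
      also have "\<dots> = of_nat ((g' * Suc n + M) * (n choose j) +
          (if j = 0 then 0 else (Suc g' * Suc n + M) * (n choose (j - 1)))) * (seg_fps ^ Suc n) $ M"
      proof (cases j)
        case 0
        then show ?thesis using E[of g' M j] n by (simp del: power_Suc)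
      next
        case (Suc i)
        \<comment> \<open>A first letter \<open>H\<close> keeps the height and uses up one of the
          \<open>j\<close>, so again \<open>n\<close> letters other than \<open>U\<close>
          remain.\<close>
        then have "n = Suc g' + M + (j - 1)" using n by simp
        then show ?thesis
          using E[of g' M j] E[of "Suc g'" M "j - 1"] n Suc
          by (simp only: of_nat_add distrib_right if_False nat.distinct simp_thms)
      qed
      also have "\<dots> = of_nat (n * (g * (Suc n choose j))) * (seg_fps ^ Suc n) $ M"
        unfolding binomial_step[OF n] g ..
      finally have "of_nat n * (of_nat (Suc n) * word_sum_not_U g M j) =
          of_nat n * (of_nat (g * (Suc n choose j)) * (seg_fps ^ Suc n) $ M)"
        by (simp only: of_nat_mult mult.assoc)
      moreover have "(of_nat n :: qpoly) \<noteq> 0" using False by simp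
      ultimately show ?thesis by (simp only: mult_cancel_left simp_thms)
    qed
  qed
qed

lemma word_sum_closed:
  assumes "N = g + M + j" "0 < N"
  shows "of_nat (N * Suc N) * word_sum g M j =
    of_nat ((g * Suc N + M) * (N choose j)) * (seg_fps ^ Suc N) $ M"
  using word_sum_from_not_U[OF word_sum_not_U_closed] assms by blast

subsection \<open>Potential polynomials and Bell polynomials\<close>

text \<open>The index set of the multinomial theorem: \<open>bell_index\<close> without its
  condition on the weighted sum. Vanishing outside \<open>A\<close> makes it finite for finite
  \<open>A\<close>.\<close>

definition exponents :: "'b set \<Rightarrow> nat \<Rightarrow> ('b \<Rightarrow> nat) set" where
  "exponents A r = {\<rho>. (\<forall>i. i \<notin> A \<longrightarrow> \<rho> i = 0) \<and> (\<Sum>i\<in>A. \<rho> i) = r}"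

lemma finite_exponents:
  assumes "finite A"
  shows "finite (exponents A r)"
proof (rule finite_subset)
  show "exponents A r \<subseteq> {\<rho>. \<forall>i. (i \<in> A \<longrightarrow> \<rho> i \<in> {..r}) \<and> (i \<notin> A \<longrightarrow> \<rho> i = 0)}"
    using assms by (auto simp: exponents_def intro: member_le_sum)
  show "finite {\<rho>. \<forall>i. (i \<in> A \<longrightarrow> \<rho> i \<in> {..r}) \<and> (i \<notin> A \<longrightarrow> \<rho> i = (0::nat))}"
    using assms by (rule finite_set_of_finite_funs) simp
qed

text \<open>Induction on \<open>A\<close>, with the binomial theorem separating the exponent of the
  new element. The map \<open>\<kappa>\<close> places the rational coefficients in the ring.\<close>

lemma multinomial:
  fixes y :: "'b \<Rightarrow> 'a::comm_ring_1" and \<kappa> :: "rat \<Rightarrow> 'a"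
  assumes "finite A" and \<kappa>_mult: "\<And>a b. \<kappa> (a * b) = \<kappa> a * \<kappa> b" and \<kappa>_of_nat: "\<And>n. \<kappa> (of_nat n) = of_nat n"
  shows "(\<Sum>i\<in>A. y i) ^ r =
    (\<Sum>\<rho>\<in>exponents A r. \<kappa> (fact r / (\<Prod>i\<in>A. fact (\<rho> i))) * (\<Prod>i\<in>A. y i ^ \<rho> i))"
  using assms(1)
proof (induction A arbitrary: r rule: finite_induct)
  case empty
  have "exponents {} r = (if r = 0 then {\<lambda>_::'b. 0} else {})"
    by (auto simp: exponents_def)
  then show ?case using \<kappa>_of_nat[of 1] by (simp add: power_0_left)
next
  case (insert b A)
  have "(\<Sum>i\<in>insert b A. y i) ^ r = (\<Sum>l\<le>r. of_nat (r choose l) * y b ^ l * (\<Sum>i\<in>A. y i) ^ (r - l))"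
    using insert.hyps by (simp add: binomial_ring)
  also have "\<dots> = (\<Sum>(l, \<rho>)\<in>Sigma {..r} (\<lambda>l. exponents A (r - l)).
      of_nat (r choose l) * y b ^ l *
        (\<kappa> (fact (r - l) / (\<Prod>i\<in>A. fact (\<rho> i))) * (\<Prod>i\<in>A. y i ^ \<rho> i)))"
    unfolding insert.IH sum_distrib_left
    by (subst sum.Sigma) (auto simp: finite_exponents insert.hyps)
  also have "\<dots> = (\<Sum>\<rho>\<in>exponents (insert b A) r.
      \<kappa> (fact r / (\<Prod>i\<in>insert b A. fact (\<rho> i))) * (\<Prod>i\<in>insert b A. y i ^ \<rho> i))"
  proof (rule sum.reindex_bij_witness
      [where i = "\<lambda>\<rho>. (\<rho> b, \<rho>(b := 0))" and j = "\<lambda>(l, \<rho>). \<rho>(b := l)"])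
    fix x assume x: "x \<in> Sigma {..r} (\<lambda>l. exponents A (r - l))"
    obtain l \<rho> where [simp]: "x = (l, \<rho>)" by (cases x)
    have \<rho>: "l \<le> r" "\<rho> \<in> exponents A (r - l)" using x by auto
    have ne: "i \<noteq> b" if "i \<in> A" for i using that insert.hyps by blast
    have upd: "(\<Sum>i\<in>A. (\<rho>(b := l)) i) = (\<Sum>i\<in>A. \<rho> i)"
        "(\<Prod>i\<in>A. fact ((\<rho>(b := l)) i)) = (\<Prod>i\<in>A. fact (\<rho> i) :: rat)"
        "(\<Prod>i\<in>A. y i ^ (\<rho>(b := l)) i) = (\<Prod>i\<in>A. y i ^ \<rho> i)"
      by (intro sum.cong prod.cong; simp add: ne)+
    show "(\<lambda>\<rho>. (\<rho> b, \<rho>(b := 0))) ((\<lambda>(l, \<rho>). \<rho>(b := l)) x) = x"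
      using \<rho> insert.hyps by (auto simp: exponents_def)
    show "(\<lambda>(l, \<rho>). \<rho>(b := l)) x \<in> exponents (insert b A) r"
      using \<rho> insert.hyps upd by (auto simp: exponents_def)
    \<comment> \<open>A multinomial coefficient is a binomial coefficient times a smaller
      multinomial one.\<close>
    have "fact r / (fact l * (\<Prod>i\<in>A. fact (\<rho> i))) =
        (of_nat (r choose l) * (fact (r - l) / (\<Prod>i\<in>A. fact (\<rho> i))) :: rat)"
      using \<rho> by (simp add: binomial_fact)
    then have "\<kappa> (fact r / (fact l * (\<Prod>i\<in>A. fact (\<rho> i)))) =
        of_nat (r choose l) * \<kappa> (fact (r - l) / (\<Prod>i\<in>A. fact (\<rho> i)))"
      by (simp only: \<kappa>_mult \<kappa>_of_nat)
    then show "\<kappa> (fact r / (\<Prod>i\<in>insert b A. fact (((\<lambda>(l, \<rho>). \<rho>(b := l)) x) i))) *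
        (\<Prod>i\<in>insert b A. y i ^ ((\<lambda>(l, \<rho>). \<rho>(b := l)) x) i) =
      (case x of (l, \<rho>) \<Rightarrow> of_nat (r choose l) * y b ^ l *
        (\<kappa> (fact (r - l) / (\<Prod>i\<in>A. fact (\<rho> i))) * (\<Prod>i\<in>A. y i ^ \<rho> i)))"
      using insert.hyps upd by (simp add: mult_ac)
  next
    fix \<rho> assume \<rho>: "\<rho> \<in> exponents (insert b A) r"
    show "(\<lambda>(l, \<rho>). \<rho>(b := l)) (\<rho> b, \<rho>(b := 0)) = \<rho>" by simp
    have "(\<Sum>i\<in>A. (\<rho>(b := 0)) i) = (\<Sum>i\<in>A. \<rho> i)"
      using insert.hyps by (intro sum.cong) auto
    then show "(\<rho> b, \<rho>(b := 0)) \<in> Sigma {..r} (\<lambda>l. exponents A (r - l))"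
      using \<rho> insert.hyps by (auto simp: exponents_def)
  qed
  finally show ?case .
qed

lemma fps_power_nth_cong:
  fixes f g :: "'a::comm_ring_1 fps"
  assumes "\<And>i. i \<le> m \<Longrightarrow> f $ i = g $ i"
  shows "(f ^ r) $ m = (g ^ r) $ m"
proof -
  \<comment> \<open>Stated for all \<open>i\<close> up to \<open>m\<close>, as the product formula
    involves the lower coefficients.\<close>
  have "(f ^ r) $ i = (g ^ r) $ i" if "i \<le> m" for i
    using that
  proof (induction r arbitrary: i)
    case (Suc r)
    then show ?case using assms by (auto simp: fps_mult_nth intro!: sum.cong)
  qed simp
  then show ?thesis by simp
qed

text \<open>This is \<open>T - 1\<close>, whose powers produce the Bell polynomials.\<close>

definition pos_seg_fps :: "qpoly fps" where
  "pos_seg_fps = Abs_fps (\<lambda>i. if i = 0 then 0 else indet i)"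

lemma seg_fps_eq: "seg_fps = 1 + pos_seg_fps"
  by (rule fps_ext) (simp add: seg_fps_def pos_seg_fps_def seg_weight_def)

text \<open>Matches the arguments \<open>i! t_i\<close> with the factors \<open>1 / i!\<close> in
  the Bell and potential polynomials.\<close>

lemma const_fact_cancel: "const (1 / fact i) * (const (fact i) * x) = x"
  by (simp flip: const_mult mult.assoc)

lemma potential_poly_eq:
  "const (1 / fact m) * potential_poly m l (\<lambda>i. const (fact i) * indet i) = (seg_fps ^ l) $ m"
proof -
  have "const (1 / fact m) * (const (fact m) * x) = x" for x
    by (rule const_fact_cancel)
  then show ?thesis
    unfolding potential_poly_def const_fact_cancel seg_fps_eq pos_seg_fps_def by simp
qed

lemma prod_fps_monomial_power:
  fixes c :: "'b \<Rightarrow> 'a::comm_ring_1"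
  shows "(\<Prod>i\<in>A. (fps_const (c i) * fps_X ^ e i) ^ \<rho> i) =
    fps_const (\<Prod>i\<in>A. c i ^ \<rho> i) * fps_X ^ (\<Sum>i\<in>A. e i * \<rho> i)"
proof (induction A rule: infinite_finite_induct)
  case (insert x A)
  then show ?case
    by (simp add: power_mult_distrib power_add mult_ac flip: fps_const_mult power_mult)
qed auto

lemma pos_seg_fps_power_nth:
  "(pos_seg_fps ^ r) $ m =
    const (fact r / fact m) * partial_bell m r (\<lambda>i. const (fact i) * indet i)"
proof -
  define y where "y i = fps_const (indet i) * fps_X ^ i" for i
  \<comment> \<open>Truncation at degree \<open>m\<close> makes the multinomial theorem applicable;
    extracting the coefficient of \<open>x^m\<close> then selects \<open>bell_index\<close>.\<close>
  have "(pos_seg_fps ^ r) $ m = ((\<Sum>i\<in>{1..m}. y i) ^ r) $ m"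
    by (rule fps_power_nth_cong)
       (auto simp: pos_seg_fps_def fps_sum_nth y_def sum.delta if_distrib cong: if_cong)
  also have "(\<Sum>i\<in>{1..m}. y i) ^ r = (\<Sum>\<rho>\<in>exponents {1..m} r.
      fps_const (const (fact r / (\<Prod>i\<in>{1..m}. fact (\<rho> i)))) * (\<Prod>i\<in>{1..m}. y i ^ \<rho> i))"
    by (rule multinomial) (simp_all add: const_mult const_of_nat fps_of_nat)
  also have "\<dots> $ m = (\<Sum>\<rho>\<in>exponents {1..m} r. if (\<Sum>i = 1..m. i * \<rho> i) = m then
      const (fact r / (\<Prod>i\<in>{1..m}. fact (\<rho> i))) * (\<Prod>i\<in>{1..m}. indet i ^ \<rho> i) else 0)"
    unfolding fps_sum_nth
  proof (rule sum.cong[OF refl])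
    fix \<rho> :: "nat \<Rightarrow> nat"
    have "(\<Prod>i\<in>{1..m}. y i ^ \<rho> i) =
        fps_const (\<Prod>i\<in>{1..m}. indet i ^ \<rho> i) * fps_X ^ (\<Sum>i = 1..m. i * \<rho> i)"
      unfolding y_def by (rule prod_fps_monomial_power)
    then show "(fps_const (const (fact r / (\<Prod>i\<in>{1..m}. fact (\<rho> i)))) * (\<Prod>i\<in>{1..m}. y i ^ \<rho> i)) $ m =
      (if (\<Sum>i = 1..m. i * \<rho> i) = m then
        const (fact r / (\<Prod>i\<in>{1..m}. fact (\<rho> i))) * (\<Prod>i\<in>{1..m}. indet i ^ \<rho> i) else 0)"
      by auto
  qed
  also have "\<dots> = (\<Sum>\<rho>\<in>bell_index m r.
      const (fact r / (\<Prod>i\<in>{1..m}. fact (\<rho> i))) * (\<Prod>i\<in>{1..m}. indet i ^ \<rho> i))"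
  proof -
    have "bell_index m r = {\<rho> \<in> exponents {1..m} r. (\<Sum>i = 1..m. i * \<rho> i) = m}"
      by (auto simp: bell_index_def exponents_def)
    then show ?thesis by (simp only: sum.inter_filter finite_exponents finite_atLeastAtMost)
  qed
  also have "\<dots> = const (fact r / fact m) * partial_bell m r (\<lambda>i. const (fact i) * indet i)"
    unfolding partial_bell_def const_fact_cancel sum_distrib_left
    by (intro sum.cong refl) (simp flip: const_mult mult.assoc)
  finally show ?thesis .
qed

text \<open>Binomial expansion of \<open>(1 + (T - 1))^l\<close>; as \<open>T - 1\<close> has no
  constant term, its powers beyond the \<open>m\<close>-th do not reach \<open>x^m\<close>.\<close>

lemma seg_fps_power_nth:
  assumes "m \<le> l"
  shows "(seg_fps ^ l) $ m = (\<Sum>r = 0..m. const (of_nat (l choose r) * (fact r / fact m)) *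
    partial_bell m r (\<lambda>i. const (fact i) * indet i))"
proof -
  have "(seg_fps ^ l) $ m = ((pos_seg_fps + 1) ^ l) $ m"
    by (simp add: seg_fps_eq add.commute)
  also have "\<dots> = (\<Sum>r\<le>l. of_nat (l choose r) * (pos_seg_fps ^ r) $ m)"
    by (simp add: binomial_ring fps_sum_nth flip: fps_of_nat)
  also have "\<dots> = (\<Sum>r = 0..m. of_nat (l choose r) * (pos_seg_fps ^ r) $ m)"
  proof (rule sum.mono_neutral_right)
    have "pos_seg_fps $ 0 = 0" by (simp add: pos_seg_fps_def)
    then show "\<forall>r\<in>{..l} - {0..m}. of_nat (l choose r) * (pos_seg_fps ^ r) $ m = 0"
      using startsby_zero_power_prefix by fastforce
  qed (use assms in auto)
  finally show ?thesis
    by (simp only: pos_seg_fps_power_nth const_mult[of "of_nat _"] const_of_nat mult.assoc)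
qed

theorem theorem4p2:
  fixes k j m n :: nat
  assumes "m \<ge> 1" and "n = 2 * m + k * j"
  shows "(\<Sum>Q\<in>Q_paths n k m j. path_weight Q) =
           const (of_nat m / (of_nat (m + j + 1) * of_nat (m + j)) * of_nat ((m + j) choose j)) *
           (const (1 / fact m) * potential_poly m (m + j + 1) (\<lambda>i. const (fact i) * indet i))
       \<and> const (of_nat m / (of_nat (m + j + 1) * of_nat (m + j)) * of_nat ((m + j) choose j)) *
           (const (1 / fact m) * potential_poly m (m + j + 1) (\<lambda>i. const (fact i) * indet i)) =
         const (of_nat m / (of_nat (m + j + 1) * of_nat (m + j)) * of_nat ((m + j) choose j)) *
           (\<Sum>r = 0..m. const (of_nat ((m + j + 1) choose r) * (fact r / fact m)) *
              partial_bell m r (\<lambda>i. const (fact i) * indet i))"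
proof
  \<comment> \<open>At height 0 the factor \<open>g * Suc N + M\<close> is just \<open>m\<close>;
    \<open>m \<ge> 1\<close> gives \<open>N > 0\<close>.\<close>
  have "of_nat ((m + j) * Suc (m + j)) * word_sum 0 m j =
      of_nat (m * ((m + j) choose j)) * (seg_fps ^ Suc (m + j)) $ m"
    using word_sum_closed[of "m + j" 0 m j] assms(1) by (simp del: power_Suc)
  then have "word_sum 0 m j =
      const (of_nat (m * ((m + j) choose j)) / of_nat ((m + j) * Suc (m + j))) *
        (seg_fps ^ Suc (m + j)) $ m"
    using assms(1) by (intro const_eqI) auto
  also have "of_nat (m * ((m + j) choose j)) / of_nat ((m + j) * Suc (m + j)) =
      of_nat m / (of_nat (m + j + 1) * of_nat (m + j)) * (of_nat ((m + j) choose j) :: rat)"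
    by (simp only: of_nat_mult Suc_eq_plus1 times_divide_eq_left mult.commute[of "of_nat (m + j)"])
  finally show "(\<Sum>Q\<in>Q_paths n k m j. path_weight Q) =
      const (of_nat m / (of_nat (m + j + 1) * of_nat (m + j)) * of_nat ((m + j) choose j)) *
        (const (1 / fact m) * potential_poly m (m + j + 1) (\<lambda>i. const (fact i) * indet i))"
    unfolding Q_paths_eq_words[OF assms(2)] potential_poly_eq word_sum_def by simp
qed (simp only: potential_poly_eq seg_fps_power_nth)

end
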